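(* Let $(G,Z,W)$ be a temporal graph-agent tuple with service arc set $A_R$, depot $v_1$ and agent set $\mathcal{K}$, and let $\mathcal{G}$ be the replicated graph constructed from $G$ with $|A_R|+1$ layers. Suppose that $(G,Z,W)$ is well-defined and $T_p$-recurrent for some $T_p\ge 0$, and that the traversal costs satisfy $c_{mk}\ge 0$ for all $a_m\in A$, $k\in\mathcal{K}$. Then $\mathcal{G}$ contains an optimal solution of the corresponding RPP-TRU problem (P); that is, the optimization problem (P) formulated over $\mathcal{G}$ has an optimal solution $(X,\Gamma,\gamma)$.
   Context: **Base data.** $G=(V,A,F^+,F^-)$ is a finite directed multi-graph; arc $a\in A$ has head $F^+(a)$ and tail $F^-(a)$. $\mathcal{K}$ is a finite set of agents, indexed $1,\dots,|\mathcal{K}|$; $v_1\in V$ is the depot (start and end location of all agents). $A_R\subset A$ is the set of service (required) arcs, $A_D=A\setminus A_R$ the deadhead arcs, and $G_D=(V,A_D,F^+,F^-)$ the deadhead graph. Agent $k$ traverses $a_m$ at cost $c_{mk}$ and in running-time $t_{mk}>0$; $W$ is the collection of all $t_{mk}$. For each $a_m\in A$, $Z_m$ is a list of pairs $(z^-,z^+)$, each meaning that $a_m$ is unavailable during the time interval from $z^-$ to $z^+$; $Z=\bigcup_m Z_m$. The triple $(G,Z,W)$ is called a temporal graph-agent tuple. An availability period (gap) of an arc is a time period between two unavailability periods. **Well-defined.** $(G,Z,W)$ is well-defined if: (1) every arc $a_m\in A$ is available, somewhere in $[0,\infty)$, for a duration at least $t_m:=\min_{k\in\mathcal{K}}t_{mk}$;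 (2) there are no availability periods of an arc that are smaller than the running-time of that arc for all agents (such gaps are treated as unavailable); (3) $G_D$ is strongly connected. **$T_p$-recurrent.** $(G,Z,W)$ is $T_p$-recurrent if each arc of $G$ is available at least once in every time interval of length $T_p$. For a well-defined tuple this is understood as: for every $t\ge 0$, every arc $a_m$ is traversable within $[t,t+T_p+t_{mk}]$ for some agent $k$. **Replicated graph.** Let $\mathcal{L}=\{1,\dots,|A_R|+1\}$ (layers). The replicated graph $\mathcal{G}=(\mathcal{V},\mathcal{A},\mathcal{F}^+,\mathcal{F}^-)$ has vertices $v_{ikl}$ for $v_i\in V$, $k\in\mathcal{K}$, $l\in\mathcal{L}$, together with a source $v_{sk0}$ and a destination $v_{dk0}$ for each $k$. Its arcs are: for each $a_m\in A_D$, $k\in\mathcal K$, $l\in\mathcal{L}$, a copy $a_{mkl}$ inside layer $l$ of agent $k$; for each $a_m\in A_R$ with tail $v_i$ and head $v_j$, each $k\in\mathcal{K}$, $1\le l\le|\mathcal{L}|-1$, a copy $a_{mkl}$ from $v_{ikl}$ to $v_{jk(l+1)}$; and virtual arcs: from $v_{sk0}$ to $v_{1k1}$, from $v_{1kl}$ to $v_{dk0}$ for each $l\ge 2$, from $v_{sk0}$ to $v_{dk0}$ (for each $k$), and inter-agent arcs from $v_{dk0}$ to $v_{sk'0}$, where $k'$ is the cyclic successor of $k$. Copies $a_{mkl}$ inherit $c_{mkl}=c_{mk}$, $t_{mkl}=t_{mk}$ and the unavailability list $Z_m$; virtual arcs have zero cost, zero running-time and no unavailabilities. $\mathcal{A}_m$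 denotes the set of all copies of $a_m\in A_R$. **Problem (P) (RPP-TRU).** Minimize $\sum_{m,k,l}c_{mkl}X_{mkl}+\beta\gamma$ (with $\beta\ge0$ a fixed trade-off parameter) over $X\in\{0,1\}^{|\mathcal{A}|}$, $\Gamma\in\mathbb{R}^{|\mathcal{V}|}$ with $\Gamma\ge0$, and $\gamma\in\mathbb{R}$, subject to: (i) at every vertex of $\mathcal{G}$ the sum of $X$ over outgoing arcs equals the sum of $X$ over incoming arcs; (ii) $\sum_{a_{mkl}\in\mathcal{A}_m}X_{mkl}=1$ for every $a_m\in A_R$; (iii) $\gamma\ge\Gamma_{dk0}$ for all $k\in\mathcal{K}$; (iv) for every arc $a_{mkl}\in\mathcal{A}$ other than the inter-agent arcs, with tail $v_{ikl}$ and head $v_{jkl'}$: $\Gamma_{jkl'}\ge t_{mkl}+\Gamma_{ikl}-\tau(1-X_{mkl})$; (v) for every copy $a_{mkl}$ of an arc $a_m\in A$, with tail $v_{jkl}$, and every $(z^-,z^+)\in Z_m$: either $\Gamma_{jkl}\le z^--t_{mkl}+\tau(1-X_{mkl})$ or $\Gamma_{jkl}\ge z^+-\tau(1-X_{mkl})$. Here $\tau$ is a very large constant, so that (iv) and (v) are imposed effectively only on arcs with $X_{mkl}=1$. *)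

theory Defs
  imports Complex_Main "Graph_Theory.Digraph_Component"
begin

text \<open>
  The graph is a finite directed multigraph with parallel arcs and loops allowed. Agents are the
  indices 1, \<dots>, \<open>num_agents\<close>. Unavailabilities are finite lists of pairs (z-, z+).
\<close>

record ('v, 'a) rpp_data =
  base_graph :: "('v, 'a) pre_digraph"
  service_arcs :: "'a set"
  depot :: 'v
  num_agents :: nat
  cost :: "'a \<Rightarrow> nat \<Rightarrow> real"
  run_time :: "'a \<Rightarrow> nat \<Rightarrow> real"
  unavail :: "'a \<Rightarrow> (real \<times> real) list"

definition agents :: "('v, 'a) rpp_data \<Rightarrow> nat set" where
  "agents D = {1..num_agents D}"

definition deadhead_graph :: "('v, 'a) rpp_data \<Rightarrow> ('v, 'a) pre_digraph" where
  "deadhead_graph D = (base_graph D)\<lparr>arcs := arcs (base_graph D) - service_arcs D\<rparr>"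

definition temporal_graph_agent_tuple :: "('v, 'a) rpp_data \<Rightarrow> bool" where
  "temporal_graph_agent_tuple D \<longleftrightarrow>
     fin_digraph (base_graph D) \<and>
     service_arcs D \<subseteq> arcs (base_graph D) \<and>
     depot D \<in> verts (base_graph D) \<and>
     num_agents D \<ge> 1 \<and>
     (\<forall>m \<in> arcs (base_graph D). \<forall>k \<in> agents D. run_time D m k > 0) \<and>
     (\<forall>m \<in> arcs (base_graph D). \<forall>(zm, zp) \<in> set (unavail D m). zm \<le> zp)"

text \<open>
  Unavailability periods count as open intervals: as in the optimization problem below, a traversal
  may end exactly at z- or start exactly at z+.
\<close>

definition available_during :: "('v, 'a) rpp_data \<Rightarrow> 'a \<Rightarrow> real \<Rightarrow> real \<Rightarrow> bool" where
  "available_during D m a b \<longleftrightarrow> (\<forall>(zm, zp) \<in> set (unavail D m). b \<le> zm \<or> zp \<le> a)"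

definition availability_gap :: "('v, 'a) rpp_data \<Rightarrow> 'a \<Rightarrow> real \<Rightarrow> real \<Rightarrow> bool" where
  "availability_gap D m a b \<longleftrightarrow>
     a < b \<and> a \<in> snd ` set (unavail D m) \<and> b \<in> fst ` set (unavail D m) \<and>
     available_during D m a b"

definition min_run_time :: "('v, 'a) rpp_data \<Rightarrow> 'a \<Rightarrow> real" where
  "min_run_time D m = Min (run_time D m ` agents D)"

definition well_defined :: "('v, 'a) rpp_data \<Rightarrow> bool" where
  "well_defined D \<longleftrightarrow>
     (\<forall>m \<in> arcs (base_graph D). \<exists>a b. 0 \<le> a \<and> min_run_time D m \<le> b - a \<and>
        available_during D m a b) \<and>
     (\<forall>m \<in> arcs (base_graph D). \<not> (\<exists>a b. availability_gap D m a b \<and>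
        (\<forall>k \<in> agents D. b - a < run_time D m k))) \<and>
     strongly_connected (deadhead_graph D)"

definition recurrent :: "('v, 'a) rpp_data \<Rightarrow> real \<Rightarrow> bool" where
  "recurrent D Tp \<longleftrightarrow>
     (\<forall>t \<ge> 0. \<forall>m \<in> arcs (base_graph D). \<exists>k \<in> agents D. \<exists>s.
        t \<le> s \<and> s + run_time D m k \<le> t + Tp + run_time D m k \<and>
        available_during D m s (s + run_time D m k))"

text \<open>
  Vertices of the replicated graph: \<open>Copy v k l\<close> is the copy of \<open>v\<close> in layer \<open>l\<close> of agent \<open>k\<close>,
  \<open>Source k\<close> and \<open>Dest k\<close> are the virtual vertices of agent \<open>k\<close>.
\<close>

datatype 'v rvertex = Copy 'v nat nat | Source nat | Dest nat

datatype 'a rarc =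
    ArcCopy 'a nat nat  \<comment> \<open>arc, agent, layer of its tail\<close>
  | Enter nat           \<comment> \<open>source to the depot in layer 1\<close>
  | Leave nat nat       \<comment> \<open>depot in the given layer to destination\<close>
  | Skip nat            \<comment> \<open>source to destination\<close>
  | Next nat            \<comment> \<open>destination to the source of the cyclically next agent\<close>

definition num_layers :: "('v, 'a) rpp_data \<Rightarrow> nat" where
  "num_layers D = card (service_arcs D) + 1"

definition next_agent :: "('v, 'a) rpp_data \<Rightarrow> nat \<Rightarrow> nat" where
  "next_agent D k = (if k = num_agents D then 1 else k + 1)"

fun rtail :: "('v, 'a) rpp_data \<Rightarrow> 'a rarc \<Rightarrow> 'v rvertex" where
  "rtail D (ArcCopy m k l) = Copy (tail (base_graph D) m) k l"
| "rtail D (Enter k) = Source k"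
| "rtail D (Leave k l) = Copy (depot D) k l"
| "rtail D (Skip k) = Source k"
| "rtail D (Next k) = Dest k"

fun rhead :: "('v, 'a) rpp_data \<Rightarrow> 'a rarc \<Rightarrow> 'v rvertex" where
  "rhead D (ArcCopy m k l) =
     Copy (head (base_graph D) m) k (if m \<in> service_arcs D then l + 1 else l)"
| "rhead D (Enter k) = Copy (depot D) k 1"
| "rhead D (Leave k l) = Dest k"
| "rhead D (Skip k) = Dest k"
| "rhead D (Next k) = Source (next_agent D k)"

definition service_copies :: "('v, 'a) rpp_data \<Rightarrow> 'a \<Rightarrow> 'a rarc set" where
  "service_copies D m = {ArcCopy m k l | k l. k \<in> agents D \<and> l \<in> {1..num_layers D - 1}}"

definition replicated_graph :: "('v, 'a) rpp_data \<Rightarrow> ('v rvertex, 'a rarc) pre_digraph" where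
  "replicated_graph D =
     \<lparr> verts =
         {Copy v k l | v k l. v \<in> verts (base_graph D) \<and> k \<in> agents D \<and> l \<in> {1..num_layers D}}
         \<union> Source ` agents D \<union> Dest ` agents D,
       arcs =
         {ArcCopy m k l | m k l. m \<in> arcs (base_graph D) - service_arcs D \<and>
            k \<in> agents D \<and> l \<in> {1..num_layers D}}
         \<union> (\<Union>m \<in> service_arcs D. service_copies D m)
         \<union> Enter ` agents D
         \<union> {Leave k l | k l. k \<in> agents D \<and> l \<in> {2..num_layers D}}
         \<union> Skip ` agents D
         \<union> Next ` agents D,
       tail = rtail D,
       head = rhead D \<rparr>"

fun rcost :: "('v, 'a) rpp_data \<Rightarrow> 'a rarc \<Rightarrow> real" where
  "rcost D (ArcCopy m k l) = cost D m k"
| "rcost D _ = 0"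

fun rrun_time :: "('v, 'a) rpp_data \<Rightarrow> 'a rarc \<Rightarrow> real" where
  "rrun_time D (ArcCopy m k l) = run_time D m k"
| "rrun_time D _ = 0"

fun runavail :: "('v, 'a) rpp_data \<Rightarrow> 'a rarc \<Rightarrow> (real \<times> real) list" where
  "runavail D (ArcCopy m k l) = unavail D m"
| "runavail D _ = []"

text \<open>
  Problem (P) for a fixed value of the constant \<open>\<tau>\<close>. Values of \<open>X\<close> and \<open>\<Gamma>\<close> outside the arcs and
  vertices of the replicated graph are unconstrained and irrelevant.
\<close>

definition rpp_feasible ::
  "('v, 'a) rpp_data \<Rightarrow> real \<Rightarrow> ('a rarc \<Rightarrow> real) \<Rightarrow> ('v rvertex \<Rightarrow> real) \<Rightarrow> real \<Rightarrow> bool" where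
  "rpp_feasible D \<tau> X \<Gamma> \<gamma> \<longleftrightarrow> (let R = replicated_graph D in
     (\<forall>e \<in> arcs R. X e \<in> {0, 1}) \<and>
     (\<forall>v \<in> verts R. \<Gamma> v \<ge> 0) \<and>
     (\<forall>v \<in> verts R. (\<Sum>e \<in> out_arcs R v. X e) = (\<Sum>e \<in> in_arcs R v. X e)) \<and>
     (\<forall>m \<in> service_arcs D. (\<Sum>e \<in> service_copies D m. X e) = 1) \<and>
     (\<forall>k \<in> agents D. \<gamma> \<ge> \<Gamma> (Dest k)) \<and>
     (\<forall>e \<in> arcs R - Next ` agents D.
        \<Gamma> (head R e) \<ge> rrun_time D e + \<Gamma> (tail R e) - \<tau> * (1 - X e)) \<and>
     (\<forall>e \<in> arcs R. \<forall>(zm, zp) \<in> set (runavail D e).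
        \<Gamma> (tail R e) \<le> zm - rrun_time D e + \<tau> * (1 - X e) \<or>
        \<Gamma> (tail R e) \<ge> zp - \<tau> * (1 - X e)))"

definition rpp_objective ::
  "('v, 'a) rpp_data \<Rightarrow> real \<Rightarrow> ('a rarc \<Rightarrow> real) \<Rightarrow> real \<Rightarrow> real" where
  "rpp_objective D \<beta> X \<gamma> = (\<Sum>e \<in> arcs (replicated_graph D). rcost D e * X e) + \<beta> * \<gamma>"

definition rpp_optimal ::
  "('v, 'a) rpp_data \<Rightarrow> real \<Rightarrow> real \<Rightarrow> ('a rarc \<Rightarrow> real) \<Rightarrow> ('v rvertex \<Rightarrow> real) \<Rightarrow> real \<Rightarrow> bool" where
  "rpp_optimal D \<beta> \<tau> X \<Gamma> \<gamma> \<longleftrightarrow>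
     rpp_feasible D \<tau> X \<Gamma> \<gamma> \<and>
     (\<forall>X' \<Gamma>' \<gamma>'. rpp_feasible D \<tau> X' \<Gamma>' \<gamma>' \<longrightarrow>
        rpp_objective D \<beta> X \<gamma> \<le> rpp_objective D \<beta> X' \<gamma>')"

end

theory Submission
  imports Defs "Graph_Theory.Euler"
begin

text \<open>
  Existence of an optimum splits into two independent facts.

  Feasible implies solvable (\<open>feasible_imp_optimal\<close>), for every \<open>\<tau>\<close>. The only discrete choices in a
  solution are the set of arcs with \<open>X = 1\<close> and, for each unavailability period of each arc, on
  which side of it the traversal lies. There are finitely many such combinations. Once they are
  fixed, the remaining constraints on \<open>\<Gamma>\<close> are lower bounds, upper bounds and inequalities
  \<open>\<Gamma> y \<ge> \<Gamma> x + c\<close>. All of these are inherited by the pointwise infimum of a family of solutions,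
  which exists because \<open>\<Gamma> \<ge> 0\<close>. So each combination that occurs at all has an earliest schedule;
  it has the least possible makespan for that combination (\<open>earliest_schedule_feasible\<close>), and the
  best of finitely many earliest schedules is optimal. No compactness is involved, which matters
  since the set of feasible \<open>\<Gamma>\<close> is unbounded.

  Feasible for large \<open>\<tau>\<close> (\<open>eventually_feasible\<close>). The unavailability lists are finite, so there is a
  time \<open>M\<close> after which every arc is free for every agent. Starting at \<open>M\<close>, agent 1 serves all service
  arcs, one per layer, moving between them through the strongly connected deadhead graph, and the
  other agents skip from source to destination. To get such a solution with \<open>X \<le> 1\<close>, the service
  arcs are ordered, the replicated graph is restricted to the arcs that agree with this order, and
  a simple path from the first source to the last destination is taken there. The restriction
  leaves a single arc between consecutive layers of agent 1, so any such path performs every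
  service exactly once. The last \<open>Next\<close> arc closes the path to a circulation, and the running
  times accumulated along the path, shifted by \<open>M\<close>, serve as \<open>\<Gamma>\<close>. On the arcs with \<open>X = 0\<close> it
  suffices that \<open>\<tau>\<close> exceeds the finitely many differences that occur in the constraints.
\<close>

section \<open>Paths and reachability in directed multigraphs\<close>

text \<open>
  The accumulated weight along the path is a well-defined function of the vertex because no vertex
  repeats. In the induction the old potential is raised by the weight of the new first arc, and
  the new start vertex gets 0.
\<close>

lemma (in wf_digraph) apath_potential:
  fixes w :: "'b \<Rightarrow> real"
  assumes "apath u p v" and "\<And>e. e \<in> set p \<Longrightarrow> 0 \<le> w e"
  shows "\<exists>f. (\<forall>x. 0 \<le> f x) \<and> (\<forall>e \<in> set p. f (tail G e) + w e \<le> f (head G e))"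
  using assms
proof (induction p arbitrary: u)
  case Nil
  show ?case by (intro exI[of _ "\<lambda>_. 0"]) simp
next
  case (Cons e p)
  then have e: "tail G e = u" "apath (head G e) p v" "u \<notin> set (awalk_verts (head G e) p)"
    by (auto simp: apath_Cons_iff)
  obtain f where f: "\<And>x. 0 \<le> f x" "\<And>a. a \<in> set p \<Longrightarrow> f (tail G a) + w a \<le> f (head G a)"
    using Cons.IH[OF e(2)] Cons.prems(2) by auto
  have w0: "0 \<le> w e" using Cons.prems(2) by simp
  have ne: "tail G a \<noteq> u \<and> head G a \<noteq> u" if "a \<in> set p" for a
    using that e awalk_verts_arc1[of a p] awalk_verts_arc2[of "head G e" p v a]
    by (auto simp: apath_def)
  have hd: "head G e \<noteq> u"
    using e hd_in_awalk_verts(2)[OF e(2)] by auto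
  let ?g = "\<lambda>x. if x = u then 0 else w e + f x"
  have "\<forall>x. 0 \<le> ?g x" using f(1) w0 by auto
  moreover have "\<forall>a \<in> set (e # p). ?g (tail G a) + w a \<le> ?g (head G a)"
    using f ne hd e(1) by (auto simp: add.assoc)
  ultimately show ?case by (intro exI[of _ ?g] conjI)
qed

text \<open>
  This lemma turns the layer structure into the statement that a path cannot avoid a service.
\<close>

lemma (in wf_digraph) awalk_uses_bridge:
  assumes "awalk u p v" "u \<in> U" "v \<notin> U"
    and "\<And>a. a \<in> arcs G \<Longrightarrow> tail G a \<in> U \<Longrightarrow> head G a \<notin> U \<Longrightarrow> a = e"
  shows "e \<in> set p"
  using assms(1,2)
proof (induction p arbitrary: u)
  case Nil
  then show ?case using assms(3) by (auto simp: awalk_Nil_iff)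
next
  case (Cons a p)
  then show ?case using assms(4)[of a] by (cases "head G a \<in> U") (auto simp: awalk_Cons_iff)
qed

lemma (in wf_digraph) reachable_image:
  assumes "u \<rightarrow>\<^sup>* v" and "wf_digraph H"
    and "\<And>x. x \<in> verts G \<Longrightarrow> \<phi> x \<in> verts H"
    and "\<And>e. e \<in> arcs G \<Longrightarrow> \<exists>a \<in> arcs H. tail H a = \<phi> (tail G e) \<and> head H a = \<phi> (head G e)"
  shows "\<phi> u \<rightarrow>\<^sup>*\<^bsub>H\<^esub> \<phi> v"
  using assms(1)
proof (induction rule: reachable_induct)
  case base
  then show ?case using assms(2,3) by (simp add: wf_digraph.reachable_refl)
next
  case (step x y)
  then obtain e where "e \<in> arcs G" "tail G e = x" "head G e = y"
    by (auto simp: arcs_ends_def arc_to_ends_def)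
  then obtain a where "a \<in> arcs H" "tail H a = \<phi> x" "head H a = \<phi> y"
    using assms(4) by blast
  then have "\<phi> x \<rightarrow>\<^bsub>H\<^esub> \<phi> y"
    by (force simp: arcs_ends_def arc_to_ends_def)
  then show ?case using step.IH assms(2) wf_digraph.reachable_adj_trans by metis
qed

lemma (in fin_digraph) closed_trail_flow:
  assumes "trail u p u" "x \<in> verts G"
  shows "(\<Sum>e \<in> out_arcs G x. of_bool (e \<in> set p)) = (\<Sum>e \<in> in_arcs G x. of_bool (e \<in> set p) :: real)"
proof -
  have "arc_set_balanced u (set p) u"
    using assms(1) by (rule arc_balancedI_trail)
  then have "arc_set_balance x (set p) = 0"
    using assms(2) by (simp add: arc_set_balanced_def)
  then have "card (out_arcs G x \<inter> set p) = card (in_arcs G x \<inter> set p)"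
    by (simp add: arc_set_balance_def)
  then show ?thesis by (simp add: finite_out_arcs finite_in_arcs)
qed

section \<open>The replicated graph\<close>

lemma tail_replicated_graph [simp]: "tail (replicated_graph D) = rtail D"
  and head_replicated_graph [simp]: "head (replicated_graph D) = rhead D"
  by (simp_all add: replicated_graph_def)

lemma verts_replicated_graph:
  "Copy v k l \<in> verts (replicated_graph D) \<longleftrightarrow>
     v \<in> verts (base_graph D) \<and> k \<in> agents D \<and> l \<in> {1..num_layers D}"
  "Source k \<in> verts (replicated_graph D) \<longleftrightarrow> k \<in> agents D"
  "Dest k \<in> verts (replicated_graph D) \<longleftrightarrow> k \<in> agents D"
  by (auto simp: replicated_graph_def)

lemma arcs_replicated_graph:
  assumes "service_arcs D \<subseteq> arcs (base_graph D)"
  shows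
  "ArcCopy m k l \<in> arcs (replicated_graph D) \<longleftrightarrow>
     m \<in> arcs (base_graph D) \<and> k \<in> agents D \<and> 1 \<le> l \<and>
     (if m \<in> service_arcs D then l < num_layers D else l \<le> num_layers D)"
  "Enter k \<in> arcs (replicated_graph D) \<longleftrightarrow> k \<in> agents D"
  "Leave k l \<in> arcs (replicated_graph D) \<longleftrightarrow> k \<in> agents D \<and> l \<in> {2..num_layers D}"
  "Skip k \<in> arcs (replicated_graph D) \<longleftrightarrow> k \<in> agents D"
  "Next k \<in> arcs (replicated_graph D) \<longleftrightarrow> k \<in> agents D"
  using assms by (auto simp: replicated_graph_def service_copies_def num_layers_def)

lemma fin_digraph_replicated_graph:
  assumes "temporal_graph_agent_tuple D"
  shows "fin_digraph (replicated_graph D)"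
proof -
  interpret B: fin_digraph "base_graph D"
    using assms by (simp add: temporal_graph_agent_tuple_def)
  have D: "service_arcs D \<subseteq> arcs (base_graph D)" "depot D \<in> verts (base_graph D)"
      "num_agents D \<ge> 1"
    using assms by (auto simp: temporal_graph_agent_tuple_def)
  let ?R = "replicated_graph D"
  let ?I = "agents D \<times> {1..num_layers D}"
  have fin: "finite (agents D)" by (simp add: agents_def)
  show ?thesis
  proof
    fix e assume e: "e \<in> arcs ?R"
    show "tail ?R e \<in> verts ?R"
      using e D by (cases e) (auto simp: arcs_replicated_graph verts_replicated_graph split: if_splits)
    show "head ?R e \<in> verts ?R"
      using e D by (cases e)
        (auto simp: arcs_replicated_graph verts_replicated_graph next_agent_def agents_def
          num_layers_def split: if_splits)
  next
    have "verts ?R \<subseteq> (\<lambda>(v, k, l). Copy v k l) ` (verts (base_graph D) \<times> ?I)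
        \<union> Source ` agents D \<union> Dest ` agents D"
      by (auto simp: replicated_graph_def image_iff)
    then show "finite (verts ?R)"
      by (rule finite_subset) (use fin in auto)
  next
    have "arcs ?R \<subseteq> (\<lambda>(m, k, l). ArcCopy m k l) ` (arcs (base_graph D) \<times> ?I)
        \<union> Enter ` agents D \<union> (\<lambda>(k, l). Leave k l) ` ?I \<union> Skip ` agents D \<union> Next ` agents D"
    proof
      fix e assume "e \<in> arcs ?R"
      then show "e \<in> (\<lambda>(m, k, l). ArcCopy m k l) ` (arcs (base_graph D) \<times> ?I)
        \<union> Enter ` agents D \<union> (\<lambda>(k, l). Leave k l) ` ?I \<union> Skip ` agents D \<union> Next ` agents D"
        by (cases e) (auto simp: arcs_replicated_graph[OF D(1)] image_iff split: if_splits)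
    qed
    then show "finite (arcs ?R)"
      by (rule finite_subset) (use fin in auto)
  qed
qed

section \<open>Feasible problems have optimal solutions\<close>

text \<open>
  The class of a solution will be its discrete part. The witness \<open>y\<close> may lie outside the class of
  \<open>x\<close>, so only its value has to be compared.
\<close>

lemma finite_classes_attain_minimum:
  fixes f :: "'x \<Rightarrow> 'y :: linorder"
  assumes "finite (\<kappa> ` F)" "F \<noteq> {}"
    and best: "\<And>x. x \<in> F \<Longrightarrow> \<exists>y \<in> F. \<forall>x' \<in> F. \<kappa> x' = \<kappa> x \<longrightarrow> f y \<le> f x'"
  shows "\<exists>y \<in> F. \<forall>x \<in> F. f y \<le> f x"
proof -
  have "\<forall>c \<in> \<kappa> ` F. \<exists>y \<in> F. \<forall>x' \<in> F. \<kappa> x' = c \<longrightarrow> f y \<le> f x'"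
    using best by blast
  then obtain g where g: "\<And>c. c \<in> \<kappa> ` F \<Longrightarrow> g c \<in> F"
      "\<And>c x. c \<in> \<kappa> ` F \<Longrightarrow> x \<in> F \<Longrightarrow> \<kappa> x = c \<Longrightarrow> f (g c) \<le> f x"
    by metis
  obtain c where c: "c \<in> \<kappa> ` F" "\<forall>c' \<in> \<kappa> ` F. f (g c) \<le> f (g c')"
    using ex_min_if_finite[of "(f \<circ> g) ` \<kappa> ` F"] assms(1,2)
    by (smt (verit, best) comp_apply finite_imageI image_iff image_is_empty not_less)
  show ?thesis
    by (rule bexI[of _ "g c"]) (use g c in \<open>auto intro: order_trans\<close>)
qed

text \<open>
  The discrete part of a solution. In a constraint whose two alternatives both hold, the first one
  is recorded; hence the second one is available whenever the pair is absent.
\<close>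

definition decisions ::
  "('v, 'a) rpp_data \<Rightarrow> real \<Rightarrow> ('a rarc \<Rightarrow> real) \<Rightarrow> ('v rvertex \<Rightarrow> real) \<Rightarrow>
     'a rarc set \<times> ('a rarc \<times> real \<times> real) set" where
  "decisions D \<tau> X \<Gamma> =
     ({e \<in> arcs (replicated_graph D). X e = 1},
      {(e, zm, zp). e \<in> arcs (replicated_graph D) \<and> (zm, zp) \<in> set (runavail D e) \<and>
         \<Gamma> (rtail D e) \<le> zm - rrun_time D e + \<tau> * (1 - X e)})"

text \<open>
  The schedule \<open>\<Gamma>\<^sub>0\<close> is the pointwise infimum over all solutions with the same decisions. A constraint
  \<open>\<Gamma> y \<ge> \<Gamma> x + c\<close> survives since \<open>\<Gamma>\<^sub>0 x + c\<close> is a lower bound of all \<open>\<Gamma>' y\<close>. An alternative of a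
  window constraint survives because all members of the class chose the same one; without that the
  infimum could fall inside the unavailability period.
\<close>

lemma earliest_schedule_feasible:
  fixes D :: "('v, 'a) rpp_data"
  assumes D: "temporal_graph_agent_tuple D" and "\<beta> \<ge> 0"
    and feas: "rpp_feasible D \<tau> X \<Gamma> \<gamma>"
  shows "\<exists>\<Gamma>\<^sub>0 \<gamma>\<^sub>0. rpp_feasible D \<tau> X \<Gamma>\<^sub>0 \<gamma>\<^sub>0 \<and>
    (\<forall>X' \<Gamma>' \<gamma>'. rpp_feasible D \<tau> X' \<Gamma>' \<gamma>' \<and> decisions D \<tau> X' \<Gamma>' = decisions D \<tau> X \<Gamma> \<longrightarrow>
       rpp_objective D \<beta> X \<gamma>\<^sub>0 \<le> rpp_objective D \<beta> X' \<gamma>')"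
proof -
  let ?R = "replicated_graph D"
  interpret R: fin_digraph ?R
    using D by (rule fin_digraph_replicated_graph)
  note [simp] = R.tail_in_verts[simplified] R.head_in_verts[simplified]
  define C where "C = {\<Gamma>'. \<exists>X' \<gamma>'. rpp_feasible D \<tau> X' \<Gamma>' \<gamma>' \<and>
    decisions D \<tau> X' \<Gamma>' = decisions D \<tau> X \<Gamma>}"
  define \<Gamma>\<^sub>0 where "\<Gamma>\<^sub>0 = (\<lambda>v. INF \<Gamma>' \<in> C. \<Gamma>' v)"
  define \<gamma>\<^sub>0 where "\<gamma>\<^sub>0 = Max ((\<lambda>k. \<Gamma>\<^sub>0 (Dest k)) ` agents D)"
  have same_X: "X' e = X e"
    if "rpp_feasible D \<tau> X' \<Gamma>' \<gamma>'" "decisions D \<tau> X' \<Gamma>' = decisions D \<tau> X \<Gamma>" "e \<in> arcs ?R"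
    for X' \<Gamma>' \<gamma>' e
  proof -
    have "X' e \<in> {0, 1}" "X e \<in> {0, 1}"
      using that(1,3) feas by (auto simp: rpp_feasible_def Let_def)
    moreover have "X' e = 1 \<longleftrightarrow> X e = 1"
      using that(2,3) by (auto simp: decisions_def)
    ultimately show ?thesis by auto
  qed
  have "\<Gamma> \<in> C" using feas by (auto simp: C_def)
  have nonneg: "0 \<le> \<Gamma>' v" if "\<Gamma>' \<in> C" "v \<in> verts ?R" for \<Gamma>' v
    using that by (auto simp: C_def rpp_feasible_def Let_def)
  have lower: "\<Gamma>\<^sub>0 v \<le> \<Gamma>' v" if "\<Gamma>' \<in> C" "v \<in> verts ?R" for \<Gamma>' v
    unfolding \<Gamma>\<^sub>0_def using that nonneg by (intro cINF_lower bdd_belowI2[of _ 0]) auto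
  have greatest: "b \<le> \<Gamma>\<^sub>0 v" if "\<And>\<Gamma>'. \<Gamma>' \<in> C \<Longrightarrow> b \<le> \<Gamma>' v" for b v
    unfolding \<Gamma>\<^sub>0_def using that \<open>\<Gamma> \<in> C\<close> by (intro cINF_greatest) auto
  have nonneg0: "0 \<le> \<Gamma>\<^sub>0 v" if "v \<in> verts ?R" for v
    using nonneg that by (intro greatest) auto
  \<comment> \<open>\<open>X\<close> instead of \<open>X'\<close> is harmless below: equal decisions force equal \<open>X\<close> on all arcs.\<close>
  have running: "rrun_time D e + \<Gamma>\<^sub>0 (rtail D e) - \<tau> * (1 - X e) \<le> \<Gamma>\<^sub>0 (rhead D e)"
    if e: "e \<in> arcs ?R" "e \<notin> Next ` agents D" for e
  proof (rule greatest)
    fix \<Gamma>' assume \<Gamma>': "\<Gamma>' \<in> C"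
    then obtain X' \<gamma>' where f: "rpp_feasible D \<tau> X' \<Gamma>' \<gamma>'"
        "decisions D \<tau> X' \<Gamma>' = decisions D \<tau> X \<Gamma>"
      by (auto simp: C_def)
    have "rrun_time D e + \<Gamma>' (rtail D e) - \<tau> * (1 - X' e) \<le> \<Gamma>' (rhead D e)"
      using f(1) e by (auto simp: rpp_feasible_def Let_def)
    then show "rrun_time D e + \<Gamma>\<^sub>0 (rtail D e) - \<tau> * (1 - X e) \<le> \<Gamma>' (rhead D e)"
      using same_X[OF f e(1)] lower[OF \<Gamma>', of "rtail D e"] e(1) by simp
  qed
  have window: "\<Gamma>\<^sub>0 (rtail D e) \<le> zm - rrun_time D e + \<tau> * (1 - X e) \<or>
      zp - \<tau> * (1 - X e) \<le> \<Gamma>\<^sub>0 (rtail D e)"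
    if e: "e \<in> arcs ?R" "(zm, zp) \<in> set (runavail D e)" for e zm zp
  proof (cases "\<Gamma> (rtail D e) \<le> zm - rrun_time D e + \<tau> * (1 - X e)")
    case True
    then show ?thesis using lower[OF \<open>\<Gamma> \<in> C\<close>, of "rtail D e"] e(1) by simp
  next
    case False
    have "zp - \<tau> * (1 - X e) \<le> \<Gamma>\<^sub>0 (rtail D e)"
    proof (rule greatest)
      fix \<Gamma>' assume "\<Gamma>' \<in> C"
      then obtain X' \<gamma>' where f: "rpp_feasible D \<tau> X' \<Gamma>' \<gamma>'"
          "decisions D \<tau> X' \<Gamma>' = decisions D \<tau> X \<Gamma>"
        by (auto simp: C_def)
      have "\<Gamma>' (rtail D e) \<le> zm - rrun_time D e + \<tau> * (1 - X' e) \<longleftrightarrow>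
          \<Gamma> (rtail D e) \<le> zm - rrun_time D e + \<tau> * (1 - X e)"
        using arg_cong[OF f(2), of "\<lambda>d. (e, zm, zp) \<in> snd d"] e by (simp add: decisions_def)
      moreover have "\<Gamma>' (rtail D e) \<le> zm - rrun_time D e + \<tau> * (1 - X' e) \<or>
          zp - \<tau> * (1 - X' e) \<le> \<Gamma>' (rtail D e)"
        using f(1) e by (fastforce simp: rpp_feasible_def Let_def)
      ultimately show "zp - \<tau> * (1 - X e) \<le> \<Gamma>' (rtail D e)"
        using False same_X[OF f e(1)] by simp
    qed
    then show ?thesis ..
  qed
  have agents: "finite (agents D)" "agents D \<noteq> {}"
    using D by (auto simp: agents_def temporal_graph_agent_tuple_def)
  have "rpp_feasible D \<tau> X \<Gamma>\<^sub>0 \<gamma>\<^sub>0"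
    using feas agents running window nonneg0
    unfolding rpp_feasible_def Let_def \<gamma>\<^sub>0_def by auto
  moreover have "rpp_objective D \<beta> X \<gamma>\<^sub>0 \<le> rpp_objective D \<beta> X' \<gamma>'"
    if f: "rpp_feasible D \<tau> X' \<Gamma>' \<gamma>'" "decisions D \<tau> X' \<Gamma>' = decisions D \<tau> X \<Gamma>" for X' \<Gamma>' \<gamma>'
  proof -
    have "\<Gamma>\<^sub>0 (Dest k) \<le> \<gamma>'" if "k \<in> agents D" for k
    proof -
      have "\<Gamma>\<^sub>0 (Dest k) \<le> \<Gamma>' (Dest k)"
        using that f by (intro lower) (auto simp: C_def verts_replicated_graph)
      also have "\<dots> \<le> \<gamma>'"
        using f(1) that by (auto simp: rpp_feasible_def Let_def)
      finally show ?thesis .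
    qed
    then have "\<gamma>\<^sub>0 \<le> \<gamma>'"
      unfolding \<gamma>\<^sub>0_def using agents by auto
    moreover have "(\<Sum>e \<in> arcs ?R. rcost D e * X e) = (\<Sum>e \<in> arcs ?R. rcost D e * X' e)"
      using same_X[OF f] by simp
    ultimately show ?thesis
      unfolding rpp_objective_def using \<open>\<beta> \<ge> 0\<close> by (simp add: mult_left_mono)
  qed
  ultimately show ?thesis by blast
qed

lemma feasible_imp_optimal:
  fixes D :: "('v, 'a) rpp_data"
  assumes D: "temporal_graph_agent_tuple D" and "\<beta> \<ge> 0"
    and "rpp_feasible D \<tau> X \<Gamma> \<gamma>"
  shows "\<exists>X \<Gamma> \<gamma>. rpp_optimal D \<beta> \<tau> X \<Gamma> \<gamma>"
proof -
  let ?R = "replicated_graph D"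
  interpret R: fin_digraph ?R
    using D by (rule fin_digraph_replicated_graph)
  define F where "F = {(X, \<Gamma>, \<gamma>). rpp_feasible D \<tau> X \<Gamma> \<gamma>}"
  let ?\<kappa> = "\<lambda>(X, \<Gamma>, \<gamma> :: real). decisions D \<tau> X \<Gamma>"
  let ?f = "\<lambda>(X, \<Gamma> :: 'v rvertex \<Rightarrow> real, \<gamma>). rpp_objective D \<beta> X \<gamma>"
  have "?\<kappa> ` F \<subseteq> Pow (arcs ?R) \<times> Pow (SIGMA e:arcs ?R. set (runavail D e))"
    by (auto simp: decisions_def)
  then have "finite (?\<kappa> ` F)"
    by (rule finite_subset) auto
  moreover have "F \<noteq> {}" using assms(3) by (auto simp: F_def)
  moreover have "\<exists>y \<in> F. \<forall>x' \<in> F. ?\<kappa> x' = ?\<kappa> x \<longrightarrow> ?f y \<le> ?f x'" if "x \<in> F" for x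
  proof -
    obtain X \<Gamma> \<gamma> where x: "x = (X, \<Gamma>, \<gamma>)" "rpp_feasible D \<tau> X \<Gamma> \<gamma>"
      using \<open>x \<in> F\<close> by (cases x) (auto simp: F_def)
    then obtain \<Gamma>\<^sub>0 \<gamma>\<^sub>0 where "rpp_feasible D \<tau> X \<Gamma>\<^sub>0 \<gamma>\<^sub>0"
      "\<forall>X' \<Gamma>' \<gamma>'. rpp_feasible D \<tau> X' \<Gamma>' \<gamma>' \<and> decisions D \<tau> X' \<Gamma>' = decisions D \<tau> X \<Gamma> \<longrightarrow>
       rpp_objective D \<beta> X \<gamma>\<^sub>0 \<le> rpp_objective D \<beta> X' \<gamma>'"
      using earliest_schedule_feasible[OF D \<open>\<beta> \<ge> 0\<close>] by blast
    then show ?thesis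
      by (intro bexI[of _ "(X, \<Gamma>\<^sub>0, \<gamma>\<^sub>0)"]) (auto simp: F_def x(1))
  qed
  ultimately have "\<exists>y \<in> F. \<forall>x \<in> F. ?f y \<le> ?f x"
    by (rule finite_classes_attain_minimum)
  then show ?thesis
    by (auto simp: F_def rpp_optimal_def)
qed

section \<open>A tour in which one agent serves everything\<close>

text \<open>
  The function \<open>h\<close> enumerates the service arcs in the order in which agent 1 is to serve them: \<open>h l\<close> is
  the only service arc that leaves layer \<open>l\<close>. Agent 1 may leave only from the last layer and may
  skip only if nothing is to be served. The \<open>Next\<close> arc of the last agent is withheld so that it is
  free to close the path. Since all service copies of the other agents are removed, they cannot
  leave layer 1 and have to skip.
\<close>

fun tour_arc :: "('v, 'a) rpp_data \<Rightarrow> (nat \<Rightarrow> 'a) \<Rightarrow> 'a rarc \<Rightarrow> bool" where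
  "tour_arc D h (ArcCopy m k l) \<longleftrightarrow> (m \<in> service_arcs D \<longrightarrow> k = 1 \<and> m = h l)"
| "tour_arc D h (Enter k) \<longleftrightarrow> True"
| "tour_arc D h (Leave k l) \<longleftrightarrow> (k = 1 \<longrightarrow> l = num_layers D)"
| "tour_arc D h (Skip k) \<longleftrightarrow> (k = 1 \<longrightarrow> service_arcs D = {})"
| "tour_arc D h (Next k) \<longleftrightarrow> k \<noteq> num_agents D"

definition tour_graph ::
  "('v, 'a) rpp_data \<Rightarrow> (nat \<Rightarrow> 'a) \<Rightarrow> ('v rvertex, 'a rarc) pre_digraph" where
  "tour_graph D h = (replicated_graph D)
     \<lparr>arcs := {e \<in> arcs (replicated_graph D). tour_arc D h e}\<rparr>"

lemma tour_graph_simps [simp]: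
  "verts (tour_graph D h) = verts (replicated_graph D)"
  "tail (tour_graph D h) = rtail D"
  "head (tour_graph D h) = rhead D"
  "arcs (tour_graph D h) = {e \<in> arcs (replicated_graph D). tour_arc D h e}"
  by (simp_all add: tour_graph_def)

lemma subgraph_tour_graph:
  assumes "temporal_graph_agent_tuple D"
  shows "subgraph (tour_graph D h) (replicated_graph D)"
proof -
  interpret R: fin_digraph "replicated_graph D"
    using assms by (rule fin_digraph_replicated_graph)
  have "wf_digraph (tour_graph D h)"
    using R.tail_in_verts R.head_in_verts by unfold_locales auto
  then show ?thesis
    by (auto simp: subgraph_def compatible_def R.wf_digraph)
qed

lemma tour_graph_reachable:
  assumes D: "temporal_graph_agent_tuple D" and sc: "strongly_connected (deadhead_graph D)"
    and h: "bij_betw h {1..card (service_arcs D)} (service_arcs D)"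
  shows "Source 1 \<rightarrow>\<^sup>*\<^bsub>tour_graph D h\<^esub> Dest (num_agents D)"
proof -
  let ?T = "tour_graph D h" and ?G = "base_graph D"
  have R: "fin_digraph (replicated_graph D)"
    using D by (rule fin_digraph_replicated_graph)
  interpret T: wf_digraph ?T
    using subgraph_tour_graph[OF D] by (simp add: subgraph_def)
  interpret B: fin_digraph ?G
    using D by (simp add: temporal_graph_agent_tuple_def)
  interpret DH: wf_digraph "deadhead_graph D"
    by unfold_locales (auto simp: deadhead_graph_def)
  have sub: "service_arcs D \<subseteq> arcs ?G" and depot: "depot D \<in> verts ?G"
    and agents: "1 \<le> num_agents D"
    using D by (auto simp: temporal_graph_agent_tuple_def)
  have k1: "1 \<in> agents D" using agents by (simp add: agents_def)
  note arcs = arcs_replicated_graph[OF sub]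
  have step: "rtail D e \<rightarrow>\<^sup>*\<^bsub>?T\<^esub> rhead D e" if "e \<in> arcs (replicated_graph D)" "tour_arc D h e" for e
    using that by (intro T.reachable_adjI T.dominatesI[of e]) (auto simp: arc_to_ends_def)
  have layer: "Copy u 1 l \<rightarrow>\<^sup>*\<^bsub>?T\<^esub> Copy v 1 l"
    if "u \<in> verts ?G" "v \<in> verts ?G" "1 \<le> l" "l \<le> num_layers D" for u v l
  proof -
    have "u \<rightarrow>\<^sup>*\<^bsub>deadhead_graph D\<^esub> v"
      using sc that by (auto simp: strongly_connected_def deadhead_graph_def)
    then show ?thesis
    proof (rule DH.reachable_image[where \<phi> = "\<lambda>x. Copy x 1 l"])
      show "wf_digraph ?T" by (rule T.wf_digraph)
      show "Copy x 1 l \<in> verts ?T" if "x \<in> verts (deadhead_graph D)" for x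
        using that \<open>1 \<le> l\<close> \<open>l \<le> num_layers D\<close> k1
        by (simp add: verts_replicated_graph deadhead_graph_def)
      show "\<exists>a \<in> arcs ?T. tail ?T a = Copy (tail (deadhead_graph D) e) 1 l \<and>
          head ?T a = Copy (head (deadhead_graph D) e) 1 l"
        if "e \<in> arcs (deadhead_graph D)" for e
        using that \<open>1 \<le> l\<close> \<open>l \<le> num_layers D\<close> k1
        by (intro bexI[of _ "ArcCopy e 1 l"]) (auto simp: deadhead_graph_def arcs)
    qed
  qed
  have copies: "Source 1 \<rightarrow>\<^sup>*\<^bsub>?T\<^esub> Copy v 1 (Suc l)"
    if "v \<in> verts ?G" "l \<le> card (service_arcs D)" for v l
    using that
  proof (induction l arbitrary: v)
    case 0
    have "Source 1 \<rightarrow>\<^sup>*\<^bsub>?T\<^esub> Copy (depot D) 1 1"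
      using step[of "Enter 1"] k1 by (simp add: arcs)
    also have "Copy (depot D) 1 1 \<rightarrow>\<^sup>*\<^bsub>?T\<^esub> Copy v 1 1"
      using 0 depot by (intro layer) (auto simp: num_layers_def)
    finally show ?case by simp
  next
    case (Suc l)
    \<comment> \<open>The index of the induction is one less than the layer, so layer \<open>Suc l\<close> is left by \<open>h (Suc l)\<close>.\<close>
    let ?m = "h (Suc l)"
    have m: "?m \<in> service_arcs D"
      using h Suc.prems by (auto simp: bij_betw_def)
    then have m': "?m \<in> arcs ?G" using sub by auto
    have "Source 1 \<rightarrow>\<^sup>*\<^bsub>?T\<^esub> Copy (tail ?G ?m) 1 (Suc l)"
      using Suc m' by simp
    also have "Copy (tail ?G ?m) 1 (Suc l) \<rightarrow>\<^sup>*\<^bsub>?T\<^esub> Copy (head ?G ?m) 1 (Suc (Suc l))"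
      using step[of "ArcCopy ?m 1 (Suc l)"] m m' k1 Suc.prems by (simp add: arcs num_layers_def)
    also have "Copy (head ?G ?m) 1 (Suc (Suc l)) \<rightarrow>\<^sup>*\<^bsub>?T\<^esub> Copy v 1 (Suc (Suc l))"
      using Suc.prems m' by (intro layer) (auto simp: num_layers_def)
    finally show ?case .
  qed
  have first: "Source 1 \<rightarrow>\<^sup>*\<^bsub>?T\<^esub> Dest 1"
  proof (cases "service_arcs D = {}")
    case True
    then show ?thesis using step[of "Skip 1"] k1 by (simp add: arcs)
  next
    case False
    moreover have "finite (service_arcs D)"
      using sub B.finite_arcs finite_subset by blast
    ultimately have "card (service_arcs D) \<ge> 1"
      by (simp add: Suc_le_eq card_gt_0_iff)
    then have "Copy (depot D) 1 (num_layers D) \<rightarrow>\<^sup>*\<^bsub>?T\<^esub> Dest 1"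
      using step[of "Leave 1 (num_layers D)"] k1 by (simp add: arcs num_layers_def)
    moreover have "Source 1 \<rightarrow>\<^sup>*\<^bsub>?T\<^esub> Copy (depot D) 1 (num_layers D)"
      using copies[of "depot D" "card (service_arcs D)"] depot by (simp add: num_layers_def)
    ultimately show ?thesis by (metis T.reachable_trans)
  qed
  have "Source 1 \<rightarrow>\<^sup>*\<^bsub>?T\<^esub> Dest (Suc k)" if "Suc k \<le> num_agents D" for k
    using that
  proof (induction k)
    case 0
    then show ?case using first by simp
  next
    case (Suc k)
    then have k: "Suc k \<in> agents D" "Suc (Suc k) \<in> agents D" "Suc k \<noteq> num_agents D"
      by (auto simp: agents_def)
    have "Source 1 \<rightarrow>\<^sup>*\<^bsub>?T\<^esub> Dest (Suc k)"
      using Suc by simp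
    also have "Dest (Suc k) \<rightarrow>\<^sup>*\<^bsub>?T\<^esub> Source (Suc (Suc k))"
      using step[of "Next (Suc k)"] k by (simp add: arcs next_agent_def)
    also have "Source (Suc (Suc k)) \<rightarrow>\<^sup>*\<^bsub>?T\<^esub> Dest (Suc (Suc k))"
      using step[of "Skip (Suc (Suc k))"] k by (simp add: arcs)
    finally show ?case .
  qed
  from this[of "num_agents D - 1"] show ?thesis using agents by simp
qed

text \<open>
  The layers up to \<open>l\<close> of agent 1, together with the source of agent 1, are left by one arc only.
\<close>

lemma tour_uses_service_arcs:
  assumes D: "temporal_graph_agent_tuple D"
    and walk: "pre_digraph.awalk (tour_graph D h) (Source 1) p (Dest k)"
    and l: "1 \<le> l" "l \<le> card (service_arcs D)"
  shows "ArcCopy (h l) 1 l \<in> set p"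
proof -
  interpret T: wf_digraph "tour_graph D h"
    using subgraph_tour_graph[OF D] by (simp add: subgraph_def)
  have sub: "service_arcs D \<subseteq> arcs (base_graph D)"
    using D by (simp add: temporal_graph_agent_tuple_def)
  have ne: "service_arcs D \<noteq> {}" using l by auto
  let ?U = "insert (Source 1) {Copy v 1 l' | v l'. l' \<le> l}"
  show ?thesis
  proof (rule T.awalk_uses_bridge[OF walk, of ?U])
    fix a assume a: "a \<in> arcs (tour_graph D h)" "tail (tour_graph D h) a \<in> ?U"
      "head (tour_graph D h) a \<notin> ?U"
    show "a = ArcCopy (h l) 1 l"
    proof (cases a)
      case (ArcCopy m k l')
      with a have l': "m \<in> service_arcs D" "l' \<le> l" "\<not> Suc l' \<le> l" "k = 1" "m = h l'"
        by (auto split: if_splits)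
      then have "l' = l" by linarith
      with l' ArcCopy show ?thesis by simp
    qed (use a l ne in \<open>auto simp: arcs_replicated_graph[OF sub] num_layers_def\<close>)
  qed auto
qed

text \<open>
  Uniqueness holds already among the arcs of the restricted graph, by injectivity of \<open>h\<close>; existence
  is the cut argument.
\<close>

lemma tour_serves_once:
  assumes D: "temporal_graph_agent_tuple D"
    and h: "bij_betw h {1..card (service_arcs D)} (service_arcs D)"
    and walk: "pre_digraph.awalk (tour_graph D h) (Source 1) p (Dest k)"
    and m: "m \<in> service_arcs D"
  shows "\<exists>e. service_copies D m \<inter> set p = {e}"
proof -
  have "m \<in> h ` {1..card (service_arcs D)}"
    using h m by (simp add: bij_betw_def)
  then obtain l where l: "1 \<le> l" "l \<le> card (service_arcs D)" "h l = m"
    by auto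
  have inj: "l' = l" if "1 \<le> l'" "l' \<le> card (service_arcs D)" "h l' = m" for l'
    using inj_onD[OF bij_betw_imp_inj_on[OF h], of l' l] l that by simp
  have "set p \<subseteq> arcs (tour_graph D h)"
    using walk by (simp add: pre_digraph.awalk_def)
  then have "service_copies D m \<inter> set p \<subseteq> {ArcCopy m 1 l}"
    using m inj by (fastforce simp: service_copies_def num_layers_def)
  moreover have "ArcCopy m 1 l \<in> set p"
    using tour_uses_service_arcs[OF D walk l(1,2)] l(3) by simp
  moreover have "ArcCopy m 1 l \<in> service_copies D m"
    using D l by (auto simp: service_copies_def num_layers_def agents_def
        temporal_graph_agent_tuple_def)
  ultimately show ?thesis by blast
qed

lemma eventually_feasible:
  fixes D :: "('v, 'a) rpp_data"
  assumes D: "temporal_graph_agent_tuple D" and sc: "strongly_connected (deadhead_graph D)"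
  shows "\<forall>\<^sub>F \<tau> in at_top. \<exists>X \<Gamma> \<gamma>. rpp_feasible D \<tau> X \<Gamma> \<gamma>"
proof -
  let ?R = "replicated_graph D" and ?G = "base_graph D" and ?K = "num_agents D"
  interpret R: fin_digraph ?R
    using D by (rule fin_digraph_replicated_graph)
  interpret B: fin_digraph ?G
    using D by (simp add: temporal_graph_agent_tuple_def)
  have sub: "service_arcs D \<subseteq> arcs ?G" and agents: "1 \<le> ?K"
    and pos: "\<And>m k. m \<in> arcs ?G \<Longrightarrow> k \<in> agents D \<Longrightarrow> 0 < run_time D m k"
    using D by (auto simp: temporal_graph_agent_tuple_def)
  note arcs = arcs_replicated_graph[OF sub]
  have fin_service: "finite (service_arcs D)"
    using sub B.finite_arcs finite_subset by blast
  obtain h where h: "bij_betw h {1..card (service_arcs D)} (service_arcs D)"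
    using ex_bij_betw_nat_finite_1[OF fin_service] by blast
  let ?T = "tour_graph D h"
  interpret T: wf_digraph ?T
    using subgraph_tour_graph[OF D] by (simp add: subgraph_def)
  obtain p where p: "T.apath (Source 1) p (Dest ?K)"
    using tour_graph_reachable[OF D sc h] T.reachable_apath by blast
  then have walk: "T.awalk (Source 1) p (Dest ?K)" by (simp add: T.apath_def)
  then have p_arcs: "set p \<subseteq> arcs ?R" and closing_new: "Next ?K \<notin> set p"
    by (auto simp: T.awalk_def)
  have pR: "R.apath (Source 1) p (Dest ?K)"
    using R.subgraph_apath_imp_apath[OF p subgraph_tour_graph[OF D]] .
  define q where "q = p @ [Next ?K]"
  have closing: "Next ?K \<in> arcs ?R" "rtail D (Next ?K) = Dest ?K" "rhead D (Next ?K) = Source 1"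
    using agents by (auto simp: arcs next_agent_def agents_def)
  have "R.trail (Source 1) q (Source 1)"
  proof -
    have "R.awalk (Dest ?K) [Next ?K] (Source 1)"
      using R.arc_implies_awalk[OF closing(1)] closing by simp
    then have "R.awalk (Source 1) q (Source 1)"
      using pR R.awalk_appendI unfolding q_def R.apath_def by blast
    moreover have "distinct p"
      using pR R.distinct_verts_imp_distinct by (auto simp: R.apath_def)
    ultimately show ?thesis
      using closing_new by (simp add: R.trail_def q_def)
  qed
  note flow = R.closed_trail_flow[OF this]
  have rt: "0 \<le> rrun_time D e" if "e \<in> arcs ?R" for e
    using that pos by (cases e) (auto simp: arcs less_imp_le)
  have "\<exists>f. (\<forall>x. 0 \<le> f x) \<and>
      (\<forall>e \<in> set p. f (tail ?R e) + rrun_time D e \<le> f (head ?R e))"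
    using p_arcs rt by (intro R.apath_potential[OF pR]) auto
  then obtain f :: "'v rvertex \<Rightarrow> real" where f: "\<And>x. 0 \<le> f x"
      "\<And>e. e \<in> set p \<Longrightarrow> f (rtail D e) + rrun_time D e \<le> f (rhead D e)"
    unfolding tail_replicated_graph head_replicated_graph by blast
  \<comment> \<open>\<open>Max Z\<close> is the time from which on no arc is unavailable; the element 0 makes it exist and keeps
      \<open>\<Gamma>\<close> nonnegative.\<close>
  define Z where "Z = insert 0 (\<Union>m \<in> arcs ?G. snd ` set (unavail D m))"
  define \<Gamma> where "\<Gamma> = (\<lambda>x. Max Z + f x)"
  define X :: "'a rarc \<Rightarrow> real" where "X = (\<lambda>e. of_bool (e \<in> set q))"
  define \<gamma> where "\<gamma> = Max ((\<lambda>k. \<Gamma> (Dest k)) ` agents D)"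
  have "finite Z" by (simp add: Z_def)
  then have Z0: "0 \<le> Max Z" by (intro Max_ge) (auto simp: Z_def)
  have late: "zp \<le> \<Gamma> x" if "e \<in> arcs ?R" "(zm, zp) \<in> set (runavail D e)" for e zm zp x
  proof -
    have "zp \<in> Z"
    proof (cases e)
      case (ArcCopy m k l)
      then have "m \<in> arcs ?G" "(zm, zp) \<in> set (unavail D m)"
        using that by (simp_all add: arcs)
      then have "zp \<in> snd ` set (unavail D m)" by (simp add: rev_image_eqI)
      with \<open>m \<in> arcs ?G\<close> show ?thesis by (auto simp: Z_def)
    qed (use that in auto)
    then have "zp \<le> Max Z" using \<open>finite Z\<close> by simp
    then show ?thesis using f(1)[of x] by (simp add: \<Gamma>_def)
  qed
  have once: "(\<Sum>e \<in> service_copies D m. X e) = 1" if "m \<in> service_arcs D" for m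
  proof -
    obtain e where e: "service_copies D m \<inter> set p = {e}"
      using tour_serves_once[OF D h walk \<open>m \<in> service_arcs D\<close>] by blast
    have "finite (service_copies D m)"
      using R.finite_arcs by (rule rev_finite_subset) (use that in \<open>auto simp: replicated_graph_def\<close>)
    moreover have "service_copies D m \<inter> set q = {e}"
      using e by (auto simp: q_def service_copies_def)
    ultimately show ?thesis
      by (simp add: X_def of_bool_def sum.If_cases)
  qed
  \<comment> \<open>From \<open>\<tau>\<^sub>0\<close> on, the running-time constraints of unused arcs are slack.\<close>
  define \<tau>\<^sub>0 where
    "\<tau>\<^sub>0 = Max (insert 0 ((\<lambda>e. rrun_time D e + \<Gamma> (rtail D e) - \<Gamma> (rhead D e)) ` arcs ?R))"
  have "rpp_feasible D \<tau> X \<Gamma> \<gamma>" if "\<tau>\<^sub>0 \<le> \<tau>" for \<tau>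
  proof -
    have "0 \<le> \<tau>\<^sub>0" by (simp add: \<tau>\<^sub>0_def)
    then have "0 \<le> \<tau>" using that by simp
    have slack: "rrun_time D e + \<Gamma> (rtail D e) - \<Gamma> (rhead D e) \<le> \<tau>" if "e \<in> arcs ?R" for e
      using \<open>\<tau>\<^sub>0 \<le> \<tau>\<close> that by (simp add: \<tau>\<^sub>0_def)
    have "\<forall>v \<in> verts ?R. (\<Sum>e \<in> out_arcs ?R v. X e) = (\<Sum>e \<in> in_arcs ?R v. X e)"
      using flow by (simp add: X_def)
    moreover have "\<forall>v \<in> verts ?R. 0 \<le> \<Gamma> v"
      using Z0 f(1) by (simp add: \<Gamma>_def)
    moreover have "\<forall>k \<in> agents D. \<gamma> \<ge> \<Gamma> (Dest k)"
      by (simp add: \<gamma>_def agents_def)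
    moreover have "\<forall>e \<in> arcs ?R - Next ` agents D.
        \<Gamma> (head ?R e) \<ge> rrun_time D e + \<Gamma> (tail ?R e) - \<tau> * (1 - X e)"
    proof
      fix e assume e: "e \<in> arcs ?R - Next ` agents D"
      show "\<Gamma> (head ?R e) \<ge> rrun_time D e + \<Gamma> (tail ?R e) - \<tau> * (1 - X e)"
      proof (cases "e \<in> set q")
        case True
        then have "e \<in> set p" using e agents by (auto simp: q_def agents_def)
        then show ?thesis using f(2)[of e] True by (simp add: X_def \<Gamma>_def)
      next
        case False
        then show ?thesis using slack[of e] e by (simp add: X_def)
      qed
    qed
    moreover have "\<forall>e \<in> arcs ?R. \<forall>(zm, zp) \<in> set (runavail D e).
        \<Gamma> (tail ?R e) \<le> zm - rrun_time D e + \<tau> * (1 - X e) \<or>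
        \<Gamma> (tail ?R e) \<ge> zp - \<tau> * (1 - X e)"
    proof (intro ballI, clarify)
      fix e zm zp
      assume e: "e \<in> arcs ?R" "(zm, zp) \<in> set (runavail D e)"
        and "\<not> zp - \<tau> * (1 - X e) \<le> \<Gamma> (tail ?R e)"
      moreover have "0 \<le> \<tau> * (1 - X e)"
        using \<open>0 \<le> \<tau>\<close> by (simp add: X_def)
      ultimately show "\<Gamma> (tail ?R e) \<le> zm - rrun_time D e + \<tau> * (1 - X e)"
        using late[OF e, of "rtail D e"] by simp
    qed
    moreover have "\<forall>e \<in> arcs ?R. X e \<in> {0, 1}" by (simp add: X_def)
    ultimately show ?thesis
      using once unfolding rpp_feasible_def Let_def by blast
  qed
  then show ?thesis
    by (intro eventually_mono[OF eventually_ge_at_top[of \<tau>\<^sub>0]]) blast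
qed

theorem mainTheorem1:
  fixes D :: "('v, 'a) rpp_data" and Tp \<beta> :: real
  assumes "temporal_graph_agent_tuple D"
    and "well_defined D"
    and "Tp \<ge> 0"
    and "recurrent D Tp"
    and "\<And>m k. m \<in> arcs (base_graph D) \<Longrightarrow> k \<in> agents D \<Longrightarrow> cost D m k \<ge> 0"
    and "\<beta> \<ge> 0"
  shows "\<forall>\<^sub>F \<tau> in at_top. \<exists>X \<Gamma> \<gamma>. rpp_optimal D \<beta> \<tau> X \<Gamma> \<gamma>"
proof -
  have "strongly_connected (deadhead_graph D)"
    using assms(2) by (simp add: well_defined_def)
  with assms(1) have "\<forall>\<^sub>F \<tau> in at_top. \<exists>X \<Gamma> \<gamma>. rpp_feasible D \<tau> X \<Gamma> \<gamma>"
    by (rule eventually_feasible)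
  then show ?thesis
    by eventually_elim (use feasible_imp_optimal assms(1,6) in blast)
qed

end
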